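(* Let $A,B,B_1,B_2,C\in\widehat{\mathbb{F}_q^\times}$ and $\lambda_1,\lambda_2\in\mathbb{F}_q$, and let $\varepsilon$ be the trivial character. (1) If $\lambda_1\neq0$, then $$\mathbb{P}_D^{(2)}\left[\begin{matrix}A; & \varepsilon\ \ B_2\\ & C\end{matrix};\lambda_1,\lambda_2\right]={}_2\mathbb{P}_1\left[\begin{matrix}B_2 & A\\ & C\end{matrix};\lambda_2\right]-B_2\overline{C}(\lambda_1)\,\overline{A}C(\lambda_1-1)\,\overline{B_2}(\lambda_1-\lambda_2).$$ (2) If $\lambda_1\neq0$, then $$\mathbb{P}_D^{(2)}\left[\begin{matrix}A; & B_1\ \ B_2\\ & A\end{matrix};\lambda_1,\lambda_2\right]=\overline{A}(\lambda_1)\;{}_2\mathbb{P}_1\left[\begin{matrix}B_2 & A\\ & A\overline{B_1}\end{matrix};\frac{\lambda_2}{\lambda_1}\right]-\overline{B_1}(1-\lambda_1)\,\overline{B_2}(1-\lambda_2).$$ (3) If $\lambda_2\neq1$, then $$\mathbb{P}_D^{(2)}\left[\begin{matrix}A; & B\ \ C\overline{B}\\ & C\end{matrix};\lambda_1,\lambda_2\right]=B\overline{A}(\lambda_2-1)\,\overline{B}(\lambda_2-\lambda_1)\;{}_2\mathbb{P}_1\left[\begin{matrix}B & B\overline{C}\\ & AB\overline{C}\end{matrix};\frac{1-\lambda_1}{\lambda_2-\lambda_1}\right]-A(-1)\,B\overline{C}(\lambda_2)\,\overline{B}(\lambda_1)+\delta(\lambda_2-\lambda_1)\,\overline{A}(\lambda_1-1)\,J(A,\overline{C}),$$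 where for $\lambda_1=\lambda_2$ the first term on the right is read as $0$ (since $\overline{B}(0)=0$). (4) If $\lambda_1\neq0,1$ and $\lambda_2\neq1$, then $$\mathbb{P}_D^{(2)}\left[\begin{matrix}\varepsilon; & B_1\ \ B_2\\ & C\end{matrix};\lambda_1,\lambda_2\right]=C\overline{B_1}(1-\lambda_1)\,\overline{C}(-\lambda_1)\,\overline{B_2}(1-\lambda_2)\;{}_2\mathbb{P}_1\left[\begin{matrix}B_2 & C\\ & C\overline{B_1}\end{matrix};\frac{\lambda_2(1-\lambda_1)}{\lambda_1(1-\lambda_2)}\right]-1.$$
   Context: $\mathbb{F}_q$ is a finite field with $q=p^e$, $p$ an odd prime. $\widehat{\mathbb{F}_q^\times}$ is the group of complex-valued multiplicative characters of $\mathbb{F}_q^\times$; every character $\chi$, including the trivial character $\varepsilon$, is extended to $\mathbb{F}_q$ by $\chi(0)=0$, and $\overline{\chi}=\chi^{-1}$. For $x\in\mathbb{F}_q$, $\delta(x)=1$ if $x=0$ and $\delta(x)=0$ otherwise. The Jacobi sum is $J(A,B)=\sum_{x\in\mathbb{F}_q}A(x)B(1-x)$. The period functions are $$\mathbb{P}_D^{(2)}\left[\begin{matrix}A; & B_1\ \ B_2\\ & C\end{matrix};\lambda_1,\lambda_2\right]=\sum_{y\in\mathbb{F}_q}A(y)\,C\overline{A}(1-y)\,\overline{B_1}(1-\lambda_1y)\,\overline{B_2}(1-\lambda_2y),$$ $${}_2\mathbb{P}_1\left[\begin{matrix}A & B\\ & C\end{matrix};\lambda\right]=\sum_{y\in\mathbb{F}_q}B(y)\,C\overline{B}(1-y)\,\overline{A}(1-\lambda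 y).$$ *)

theory Defs
  imports Complex_Main "HOL-Computational_Algebra.Primes"
begin

text \<open>
  A finite field is a type of sort \<open>{field, finite}\<close>. A multiplicative character is
  represented by its extension by zero to the whole field: the unit-group homomorphism into the
  nonzero complex numbers is recorded by the last two conditions.
\<close>

definition mult_chars :: "('a::{field,finite} \<Rightarrow> complex) set" where
  "mult_chars = {\<chi>. \<chi> 0 = 0 \<and> (\<forall>x. x \<noteq> 0 \<longrightarrow> \<chi> x \<noteq> 0) \<and>
     (\<forall>x y. x \<noteq> 0 \<longrightarrow> y \<noteq> 0 \<longrightarrow> \<chi> (x * y) = \<chi> x * \<chi> y)}"

definition triv_char :: "'a::{field,finite} \<Rightarrow> complex" where
  "triv_char x = (if x = 0 then 0 else 1)"

definition char_mult ::
  "('a::{field,finite} \<Rightarrow> complex) \<Rightarrow> ('a \<Rightarrow> complex) \<Rightarrow> 'a \<Rightarrow> complex" (infixl "\<cdot>" 70) where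
  "A \<cdot> B = (\<lambda>x. A x * B x)"

text \<open>The inverse character; at \<open>0\<close> the value is \<open>0\<close> because \<open>inverse 0 = 0\<close>.\<close>

definition char_inv :: "('a::{field,finite} \<Rightarrow> complex) \<Rightarrow> 'a \<Rightarrow> complex" where
  "char_inv A = (\<lambda>x. inverse (A x))"

text \<open>With these operations the characters form an abelian group.\<close>

lemma triv_char_in_mult_chars: "triv_char \<in> mult_chars"
  by (simp add: mult_chars_def triv_char_def)

lemma char_mult_in_mult_chars: "A \<in> mult_chars \<Longrightarrow> B \<in> mult_chars \<Longrightarrow> A \<cdot> B \<in> mult_chars"
  by (simp add: mult_chars_def char_mult_def)

lemma char_inv_in_mult_chars: "A \<in> mult_chars \<Longrightarrow> char_inv A \<in> mult_chars"
  by (simp add: mult_chars_def char_inv_def)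

lemma char_mult_assoc: "(A \<cdot> B) \<cdot> C = A \<cdot> (B \<cdot> C)"
  by (simp add: char_mult_def mult.assoc)

lemma char_mult_commute: "A \<cdot> B = B \<cdot> A"
  by (simp add: char_mult_def mult.commute)

lemma triv_char_mult: "A \<in> mult_chars \<Longrightarrow> triv_char \<cdot> A = A"
  by (auto simp: mult_chars_def char_mult_def triv_char_def)

lemma char_inv_mult: "A \<in> mult_chars \<Longrightarrow> char_inv A \<cdot> A = triv_char"
  by (auto simp: mult_chars_def char_mult_def char_inv_def triv_char_def)

definition delta :: "'a::{field,finite} \<Rightarrow> complex" where
  "delta x = (if x = 0 then 1 else 0)"

definition jacobi_sum ::
  "('a::{field,finite} \<Rightarrow> complex) \<Rightarrow> ('a \<Rightarrow> complex) \<Rightarrow> complex" where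
  "jacobi_sum A B = (\<Sum>x\<in>UNIV. A x * B (1 - x))"

text \<open>In \<open>period_D2 A B\<^sub>1 B\<^sub>2 C l\<^sub>1 l\<^sub>2\<close>, \<open>A; B\<^sub>1 B\<^sub>2\<close> is the upper row and \<open>C\<close> the lower entry.\<close>

definition period_D2 ::
  "('a::{field,finite} \<Rightarrow> complex) \<Rightarrow> ('a \<Rightarrow> complex) \<Rightarrow> ('a \<Rightarrow> complex) \<Rightarrow> ('a \<Rightarrow> complex)
     \<Rightarrow> 'a \<Rightarrow> 'a \<Rightarrow> complex" where
  "period_D2 A B\<^sub>1 B\<^sub>2 C l\<^sub>1 l\<^sub>2 =
     (\<Sum>y\<in>UNIV. A y * (C \<cdot> char_inv A) (1 - y)
        * char_inv B\<^sub>1 (1 - l\<^sub>1 * y) * char_inv B\<^sub>2 (1 - l\<^sub>2 * y))"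

text \<open>\<open>period_21 A B C l\<close> has upper row \<open>A B\<close> and lower entry \<open>C\<close>; it is the second
  upper parameter \<open>B\<close> that is evaluated at the summation variable.\<close>

definition period_21 ::
  "('a::{field,finite} \<Rightarrow> complex) \<Rightarrow> ('a \<Rightarrow> complex) \<Rightarrow> ('a \<Rightarrow> complex) \<Rightarrow> 'a \<Rightarrow> complex" where
  "period_21 A B C l =
     (\<Sum>y\<in>UNIV. B y * (C \<cdot> char_inv B) (1 - y) * char_inv A (1 - l * y))"

end

theory Submission
  imports Defs
begin

text \<open>
  In each case an affine or Moebius change of variable turns the left-hand sum into a
  \<open>2P1\<close>-sum termwise; the correction terms are the points at which a trivial
  character vanishes, and the value at infinity of the change of variable.
\<close>

lemma mult_char_zero: "\<chi> \<in> mult_chars \<Longrightarrow> \<chi> 0 = 0"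
  by (simp add: mult_chars_def)

lemma mult_char_eq_0_iff: "\<chi> \<in> mult_chars \<Longrightarrow> \<chi> x = 0 \<longleftrightarrow> x = 0"
  by (auto simp: mult_chars_def)

text \<open>Extension by zero makes multiplicativity hold without side conditions, so characters of
  products can be split without separating off zero factors.\<close>

lemma mult_char_mult: "\<chi> \<in> mult_chars \<Longrightarrow> \<chi> (x * y) = \<chi> x * \<chi> y"
  by (cases "x = 0"; cases "y = 0") (auto simp: mult_chars_def)

lemma mult_char_one: "\<chi> \<in> mult_chars \<Longrightarrow> \<chi> 1 = 1"
  using mult_char_mult[of \<chi> 1 1] mult_char_eq_0_iff[of \<chi> 1] by simp

lemma mult_char_inverse:
  assumes "\<chi> \<in> mult_chars"
  shows "\<chi> (inverse x) = inverse (\<chi> x)"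
proof (cases "x = 0")
  case False
  then have "\<chi> x * \<chi> (inverse x) = 1"
    using mult_char_mult[OF assms, of x "inverse x"] mult_char_one[OF assms] by simp
  then show ?thesis by (simp add: inverse_unique)
qed (simp add: mult_char_zero[OF assms])

lemma mult_char_divide: "\<chi> \<in> mult_chars \<Longrightarrow> \<chi> (x / y) = \<chi> x / \<chi> y"
  by (simp add: divide_inverse mult_char_mult mult_char_inverse)

lemma mult_char_diff_commute:
  assumes "\<chi> \<in> mult_chars"
  shows "\<chi> (x - y) = \<chi> (- 1) * \<chi> (y - x)"
  using mult_char_mult[OF assms, of "- 1" "y - x"] by simp

lemmas mult_char_simps =
  mult_char_zero mult_char_eq_0_iff mult_char_mult mult_char_one mult_char_divide

text \<open>The Moebius map has determinant \<open>1 - l\<close>, hence is invertible on the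
  projective line. It sends \<open>1\<close> to infinity and infinity to \<open>l\<close>, so
  removing these points leaves a bijection of the affine parts.\<close>

lemma sum_moebius_substitution:
  fixes l :: "'a::{field,finite}" and f :: "'a \<Rightarrow> 'b::comm_monoid_add"
  assumes "l \<noteq> 1"
  shows "(\<Sum>y\<in>UNIV - {1}. f ((1 - l * y) / (1 - y))) = (\<Sum>z\<in>UNIV - {l}. f z)"
proof (rule sum.reindex_bij_witness[where i = "\<lambda>z. (z - 1) / (z - l)"
      and j = "\<lambda>y. (1 - l * y) / (1 - y)"])
  fix y assume "y \<in> UNIV - {1 :: 'a}"
  then have y: "1 - y \<noteq> 0" by auto
  have e: "(1 - l * y) / (1 - y) - l = (1 - l) / (1 - y)"
    using y by (simp add: field_simps)
  have e': "(1 - l * y) / (1 - y) - 1 = (1 - l) * y / (1 - y)"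
    using y by (simp add: field_simps)
  show "((1 - l * y) / (1 - y) - 1) / ((1 - l * y) / (1 - y) - l) = y"
    unfolding e e' using y assms by simp
  have "(1 - l * y) / (1 - y) - l \<noteq> 0"
    unfolding e using y assms by simp
  then show "(1 - l * y) / (1 - y) \<in> UNIV - {l}" by auto
next
  fix z assume "z \<in> UNIV - {l}"
  then have z: "z - l \<noteq> 0" by auto
  have e: "1 - (z - 1) / (z - l) = (1 - l) / (z - l)"
    using z by (simp add: field_simps)
  have e': "1 - l * ((z - 1) / (z - l)) = z * (1 - l) / (z - l)"
    using z by (simp add: field_simps)
  show "(1 - l * ((z - 1) / (z - l))) / (1 - (z - 1) / (z - l)) = z"
    unfolding e e' using z assms by simp
  have "1 - (z - 1) / (z - l) \<noteq> 0"
    unfolding e using z assms by simp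
  then show "(z - 1) / (z - l) \<in> UNIV - {1}" by auto
qed simp

text \<open>The factor \<open>char_inv triv_char\<close> is \<open>1\<close> except at the root of
  \<open>1 - l\<^sub>1 * y\<close>; the correction is the \<open>2P1\<close>-summand at that
  root.\<close>

lemma period_D2_triv_char:
  fixes A B\<^sub>2 C :: "'a::{field,finite} \<Rightarrow> complex"
  assumes chars: "A \<in> mult_chars" "B\<^sub>2 \<in> mult_chars" "C \<in> mult_chars"
    and l\<^sub>1: "l\<^sub>1 \<noteq> 0"
  shows "period_D2 A triv_char B\<^sub>2 C l\<^sub>1 l\<^sub>2 =
    period_21 B\<^sub>2 A C l\<^sub>2
      - (B\<^sub>2 \<cdot> char_inv C) l\<^sub>1 * (char_inv A \<cdot> C) (l\<^sub>1 - 1) * char_inv B\<^sub>2 (l\<^sub>1 - l\<^sub>2)"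
proof -
  note [simp] = mult_char_simps[OF chars(1)] mult_char_simps[OF chars(2)] mult_char_simps[OF chars(3)]
  define h where "h y = A y * (C \<cdot> char_inv A) (1 - y) * char_inv B\<^sub>2 (1 - l\<^sub>2 * y)" for y
  have root: "l\<^sub>1 * y = 1 \<longleftrightarrow> y = 1 / l\<^sub>1" for y
    using l\<^sub>1 by (auto simp: field_simps)
  have "period_D2 A triv_char B\<^sub>2 C l\<^sub>1 l\<^sub>2 = (\<Sum>y\<in>UNIV. h y - (if y = 1 / l\<^sub>1 then h y else 0))"
    unfolding period_D2_def h_def
    by (rule sum.cong) (auto simp: char_inv_def[of triv_char] triv_char_def root)
  also have "\<dots> = period_21 B\<^sub>2 A C l\<^sub>2 - h (1 / l\<^sub>1)"
    by (simp add: sum_subtractf h_def period_21_def)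
  also have "h (1 / l\<^sub>1) =
      (B\<^sub>2 \<cdot> char_inv C) l\<^sub>1 * (char_inv A \<cdot> C) (l\<^sub>1 - 1) * char_inv B\<^sub>2 (l\<^sub>1 - l\<^sub>2)"
  proof -
    \<comment> \<open>The denominators contribute the inverses of \<open>A\<close>, of
      \<open>C / A\<close> and of \<open>1 / B\<^sub>2\<close> at \<open>l\<^sub>1\<close>, whose
      product is \<open>B\<^sub>2 / C\<close> there.\<close>
    have "1 - 1 / l\<^sub>1 = (l\<^sub>1 - 1) / l\<^sub>1" "1 - l\<^sub>2 * (1 / l\<^sub>1) = (l\<^sub>1 - l\<^sub>2) / l\<^sub>1"
      using l\<^sub>1 by (simp_all add: field_simps)
    then show ?thesis
      using l\<^sub>1 by (simp add: h_def char_mult_def char_inv_def divide_simps)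
  qed
  finally show ?thesis .
qed

text \<open>The factor at \<open>1 - y\<close> becomes trivial and only deletes
  \<open>y = 1\<close>. The full sum is then rescaled by \<open>z = l\<^sub>1 * y\<close>.\<close>

lemma period_D2_lower_eq_upper:
  fixes A B\<^sub>1 B\<^sub>2 :: "'a::{field,finite} \<Rightarrow> complex"
  assumes chars: "A \<in> mult_chars" "B\<^sub>1 \<in> mult_chars" "B\<^sub>2 \<in> mult_chars"
    and l\<^sub>1: "l\<^sub>1 \<noteq> 0"
  shows "period_D2 A B\<^sub>1 B\<^sub>2 A l\<^sub>1 l\<^sub>2 =
    char_inv A l\<^sub>1 * period_21 B\<^sub>2 A (A \<cdot> char_inv B\<^sub>1) (l\<^sub>2 / l\<^sub>1)
      - char_inv B\<^sub>1 (1 - l\<^sub>1) * char_inv B\<^sub>2 (1 - l\<^sub>2)"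
proof -
  note [simp] = mult_char_simps[OF chars(1)] mult_char_simps[OF chars(2)] mult_char_simps[OF chars(3)]
  define h where "h y = A y * char_inv B\<^sub>1 (1 - l\<^sub>1 * y) * char_inv B\<^sub>2 (1 - l\<^sub>2 * y)" for y
  have "period_D2 A B\<^sub>1 B\<^sub>2 A l\<^sub>1 l\<^sub>2 = (\<Sum>y\<in>UNIV. h y - (if y = 1 then h y else 0))"
    unfolding period_D2_def h_def
    by (rule sum.cong) (auto simp: char_mult_def char_inv_def[of A])
  also have "\<dots> = (\<Sum>y\<in>UNIV. h y) - h 1"
    by (simp add: sum_subtractf)
  also have "(\<Sum>y\<in>UNIV. h y) = (\<Sum>z\<in>UNIV. h (z / l\<^sub>1))"
    by (rule sum.reindex_bij_witness[where i = "\<lambda>z. z / l\<^sub>1" and j = "\<lambda>y. l\<^sub>1 * y"])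
      (use l\<^sub>1 in auto)
  \<comment> \<open>The prefactor comes from \<open>A (z / l\<^sub>1)\<close>. The lower entry is
    such that its quotient by \<open>A\<close> is the inverse of \<open>B\<^sub>1\<close>; at
    \<open>z = 1\<close> both summands vanish.\<close>
  also have "\<dots> = char_inv A l\<^sub>1 * period_21 B\<^sub>2 A (A \<cdot> char_inv B\<^sub>1) (l\<^sub>2 / l\<^sub>1)"
    unfolding period_21_def sum_distrib_left h_def
    by (rule sum.cong) (use l\<^sub>1 in \<open>auto simp: char_mult_def char_inv_def divide_simps\<close>)
  finally show ?thesis by (simp add: h_def)
qed

text \<open>The trivial character deletes only \<open>y = 0\<close>. The affine map sending
  \<open>y = 1\<close> to \<open>0\<close> and \<open>y = 1 / l\<^sub>1\<close> to \<open>1\<close>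
  brings the remaining factors into \<open>2P1\<close> form.\<close>

lemma period_D2_upper_eq_triv_char:
  fixes B\<^sub>1 B\<^sub>2 C :: "'a::{field,finite} \<Rightarrow> complex"
  assumes chars: "B\<^sub>1 \<in> mult_chars" "B\<^sub>2 \<in> mult_chars" "C \<in> mult_chars"
    and l: "l\<^sub>1 \<noteq> 0" "l\<^sub>1 \<noteq> 1" "l\<^sub>2 \<noteq> 1"
  shows "period_D2 triv_char B\<^sub>1 B\<^sub>2 C l\<^sub>1 l\<^sub>2 =
    (C \<cdot> char_inv B\<^sub>1) (1 - l\<^sub>1) * char_inv C (- l\<^sub>1) * char_inv B\<^sub>2 (1 - l\<^sub>2)
      * period_21 B\<^sub>2 C (C \<cdot> char_inv B\<^sub>1) ((l\<^sub>2 * (1 - l\<^sub>1)) / (l\<^sub>1 * (1 - l\<^sub>2))) - 1"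
proof -
  note [simp] = mult_char_simps[OF chars(1)] mult_char_simps[OF chars(2)] mult_char_simps[OF chars(3)]
  \<comment> \<open>For nonzero \<open>l\<^sub>2\<close>, the factor \<open>1 - m * z\<close> must
    vanish at the image of \<open>y = 1 / l\<^sub>2\<close>; this dictates \<open>m\<close>.\<close>
  define m where "m = (l\<^sub>2 * (1 - l\<^sub>1)) / (l\<^sub>1 * (1 - l\<^sub>2))"
  define h where "h y = C (1 - y) * char_inv B\<^sub>1 (1 - l\<^sub>1 * y) * char_inv B\<^sub>2 (1 - l\<^sub>2 * y)" for y
  define k where
    "k z = C z * ((C \<cdot> char_inv B\<^sub>1) \<cdot> char_inv C) (1 - z) * char_inv B\<^sub>2 (1 - m * z)" for z
  define c where "c = (C \<cdot> char_inv B\<^sub>1) (1 - l\<^sub>1) * char_inv C (- l\<^sub>1) * char_inv B\<^sub>2 (1 - l\<^sub>2)"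
  have nz: "1 - l\<^sub>1 \<noteq> 0" "1 - l\<^sub>2 \<noteq> 0" "- l\<^sub>1 \<noteq> 0" using l by auto
  have "period_D2 triv_char B\<^sub>1 B\<^sub>2 C l\<^sub>1 l\<^sub>2 = (\<Sum>y\<in>UNIV. h y - (if y = 0 then h y else 0))"
    unfolding period_D2_def h_def
    by (rule sum.cong) (auto simp: char_mult_def char_inv_def triv_char_def)
  \<comment> \<open>All three characters in \<open>h 0\<close> are evaluated at
    \<open>1\<close>.\<close>
  also have "\<dots> = (\<Sum>y\<in>UNIV. h y) - 1"
    by (simp add: sum_subtractf h_def char_inv_def)
  also have "(\<Sum>y\<in>UNIV. h y) = (\<Sum>y\<in>UNIV. c * k (- l\<^sub>1 * (1 - y) / (1 - l\<^sub>1)))"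
  proof (rule sum.cong)
    fix y
    have e1: "1 - (- l\<^sub>1 * (1 - y) / (1 - l\<^sub>1)) = (1 - l\<^sub>1 * y) / (1 - l\<^sub>1)"
      using nz by (simp add: field_simps)
    have "m * (- l\<^sub>1 * (1 - y) / (1 - l\<^sub>1)) = - (l\<^sub>2 * (1 - y)) / (1 - l\<^sub>2)"
      unfolding m_def using nz by simp
    then have e2: "1 - m * (- l\<^sub>1 * (1 - y) / (1 - l\<^sub>1)) = (1 - l\<^sub>2 * y) / (1 - l\<^sub>2)"
      using nz by (simp add: field_simps)
    have nz': "C (1 - l\<^sub>1) \<noteq> 0" "B\<^sub>1 (1 - l\<^sub>1) \<noteq> 0" "B\<^sub>2 (1 - l\<^sub>2) \<noteq> 0" "C (- l\<^sub>1) \<noteq> 0"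
      using nz by simp_all
    \<comment> \<open>The factor \<open>C (- l\<^sub>1)\<close> is kept whole so that it cancels
      against the one in \<open>c\<close>.\<close>
    have C: "C (- l\<^sub>1 * (1 - y) / (1 - l\<^sub>1)) = C (- l\<^sub>1) * C (1 - y) / C (1 - l\<^sub>1)"
      by (simp only: mult_char_mult[OF chars(3)] mult_char_divide[OF chars(3)])
    show "h y = c * k (- l\<^sub>1 * (1 - y) / (1 - l\<^sub>1))"
      unfolding h_def k_def c_def e1 e2 C char_mult_def char_inv_def
      using nz' l by (simp add: divide_simps)
  qed simp
  also have "\<dots> = (\<Sum>z\<in>UNIV. c * k z)"
    by (rule sum.reindex_bij_witness[where i = "\<lambda>z. 1 + z * (1 - l\<^sub>1) / l\<^sub>1"
          and j = "\<lambda>y. - l\<^sub>1 * (1 - y) / (1 - l\<^sub>1)"])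
      (use nz in \<open>auto simp: divide_simps\<close>)
  also have "\<dots> = c * period_21 B\<^sub>2 C (C \<cdot> char_inv B\<^sub>1) m"
    by (simp add: sum_distrib_left period_21_def k_def)
  finally show ?thesis unfolding c_def m_def .
qed

text \<open>The parameters \<open>B\<close> and \<open>C / B\<close> multiply to the lower entry
  \<open>C\<close>, so off \<open>y = 1\<close> the summand depends only on \<open>y\<close>,
  \<open>1 - l\<^sub>1 * y\<close> and \<open>1 - l\<^sub>2 * y\<close>, each divided by
  \<open>1 - y\<close>. All three are expressible through the Moebius variable
  \<open>z\<close>.\<close>

lemma period_D2_balanced:
  fixes A B C :: "'a::{field,finite} \<Rightarrow> complex"
  assumes chars: "A \<in> mult_chars" "B \<in> mult_chars" "C \<in> mult_chars"
    and l\<^sub>2: "l\<^sub>2 \<noteq> 1"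
  shows "period_D2 A B (C \<cdot> char_inv B) C l\<^sub>1 l\<^sub>2 =
    (B \<cdot> char_inv A) (l\<^sub>2 - 1) * char_inv B (l\<^sub>2 - l\<^sub>1)
        * period_21 B (B \<cdot> char_inv C) (A \<cdot> B \<cdot> char_inv C) ((1 - l\<^sub>1) / (l\<^sub>2 - l\<^sub>1))
      - A (- 1) * (B \<cdot> char_inv C) l\<^sub>2 * char_inv B l\<^sub>1
      + delta (l\<^sub>2 - l\<^sub>1) * char_inv A (l\<^sub>1 - 1) * jacobi_sum A (char_inv C)"
proof -
  note [simp] = mult_char_simps[OF chars(1)] mult_char_simps[OF chars(2)] mult_char_simps[OF chars(3)]
  define h where "h y = A y * (C \<cdot> char_inv A) (1 - y)
      * char_inv B (1 - l\<^sub>1 * y) * char_inv (C \<cdot> char_inv B) (1 - l\<^sub>2 * y)" for y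
  text \<open>The substitution \<open>z = (1 - l\<^sub>2 y) / (1 - y)\<close> sends the pole \<open>y = 1\<close>, where the summand
    vanishes, to infinity, and misses \<open>z = l\<^sub>2\<close>.\<close>
  have D: "period_D2 A B (C \<cdot> char_inv B) C l\<^sub>1 l\<^sub>2 = c * ((\<Sum>z\<in>UNIV. k z) - k l\<^sub>2)"
    if hk: "\<And>y. y \<noteq> 1 \<Longrightarrow> h y = c * k ((1 - l\<^sub>2 * y) / (1 - y))" for c k
  proof -
    have "period_D2 A B (C \<cdot> char_inv B) C l\<^sub>1 l\<^sub>2 = (\<Sum>y\<in>UNIV - {1}. h y)"
      unfolding period_D2_def h_def
      by (rule sum.mono_neutral_right) (auto simp: char_mult_def)
    also have "\<dots> = (\<Sum>y\<in>UNIV - {1}. c * k ((1 - l\<^sub>2 * y) / (1 - y)))"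
      by (rule sum.cong) (auto simp: hk)
    also have "\<dots> = (\<Sum>z\<in>UNIV - {l\<^sub>2}. c * k z)"
      by (rule sum_moebius_substitution[OF l\<^sub>2])
    also have "\<dots> = c * ((\<Sum>z\<in>UNIV. k z) - k l\<^sub>2)"
      by (simp add: sum_distrib_left [symmetric] sum_diff1)
    finally show ?thesis .
  qed
  have nz: "l\<^sub>2 - 1 \<noteq> 0" using l\<^sub>2 by simp
  have one_minus: "1 - (1 - l\<^sub>2 * y) / (1 - y) = (l\<^sub>2 - 1) * y / (1 - y)" if "y \<noteq> 1" for y
    using that by (simp add: field_simps)
  \<comment> \<open>The missed point contributes \<open>A (1 - l\<^sub>2)\<close>, while the
    prefactors contain \<open>A (l\<^sub>2 - 1)\<close>; this is the source of
    \<open>A (- 1)\<close>.\<close>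
  have A_swap: "A (1 - l\<^sub>2) = A (- 1) * A (l\<^sub>2 - 1)"
    by (rule mult_char_diff_commute[OF chars(1)])
  show ?thesis
  proof (cases "l\<^sub>1 = l\<^sub>2")
    case True
    \<comment> \<open>The two linear factors coincide, so \<open>B\<close> cancels and a Jacobi sum
      remains.\<close>
    define k where "k z = A (1 - z) * char_inv C z" for z
    have "h y = char_inv A (l\<^sub>2 - 1) * k ((1 - l\<^sub>2 * y) / (1 - y))" if "y \<noteq> 1" for y
      using that nz unfolding h_def k_def one_minus[OF that] True
      by (simp add: char_mult_def char_inv_def divide_simps)
    then have "period_D2 A B (C \<cdot> char_inv B) C l\<^sub>1 l\<^sub>2
        = char_inv A (l\<^sub>2 - 1) * ((\<Sum>z\<in>UNIV. k z) - k l\<^sub>2)"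
      by (rule D)
    also have "(\<Sum>z\<in>UNIV. k z) = jacobi_sum A (char_inv C)"
      unfolding jacobi_sum_def k_def
      by (rule sum.reindex_bij_witness[where i = "\<lambda>z. 1 - z" and j = "\<lambda>z. 1 - z"]) auto
    \<comment> \<open>The first term on the right vanishes through \<open>B 0 = 0\<close>, whatever
      value the division by zero gives to the argument of \<open>period_21\<close>.\<close>
    finally show ?thesis
      using nz True
      by (auto simp: k_def A_swap delta_def char_mult_def char_inv_def right_diff_distrib
          divide_simps)
  next
    case False
    then have ne: "l\<^sub>2 - l\<^sub>1 \<noteq> 0" by simp
    \<comment> \<open>When \<open>l\<^sub>1\<close> is neither \<open>0\<close> nor
      \<open>1\<close>, \<open>1 / m\<close> is the image of \<open>y = 1 / l\<^sub>1\<close>, so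
      that \<open>1 - m * z\<close> carries the factor \<open>1 - l\<^sub>1 * y\<close>.\<close>
    define m where "m = (1 - l\<^sub>1) / (l\<^sub>2 - l\<^sub>1)"
    define c where "c = (B \<cdot> char_inv A) (l\<^sub>2 - 1) * char_inv B (l\<^sub>2 - l\<^sub>1)"
    define k where "k z = (B \<cdot> char_inv C) z
        * ((A \<cdot> B \<cdot> char_inv C) \<cdot> char_inv (B \<cdot> char_inv C)) (1 - z) * char_inv B (1 - m * z)" for z
    \<comment> \<open>The lower entry divided by \<open>B / C\<close> is \<open>A\<close>; where
      \<open>B / C\<close> could vanish inside this quotient, at \<open>z = 1\<close>, both sides
      are \<open>0\<close>.\<close>
    have k: "k z = (B z / C z) * A (1 - z) / B (1 - m * z)" for z
      by (cases "z = 1") (auto simp: k_def char_mult_def char_inv_def divide_simps)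
    have "h y = c * k ((1 - l\<^sub>2 * y) / (1 - y))" if y: "y \<noteq> 1" for y
    proof -
      have y': "1 - y \<noteq> 0" using y by simp
      have "m * ((1 - l\<^sub>2 * y) / (1 - y)) = (1 - l\<^sub>1) * (1 - l\<^sub>2 * y) / ((l\<^sub>2 - l\<^sub>1) * (1 - y))"
        by (simp add: m_def)
      then have "1 - m * ((1 - l\<^sub>2 * y) / (1 - y))
          = ((l\<^sub>2 - l\<^sub>1) * (1 - y) - (1 - l\<^sub>1) * (1 - l\<^sub>2 * y)) / ((l\<^sub>2 - l\<^sub>1) * (1 - y))"
        using y' ne by (simp add: diff_divide_distrib)
      also have "(l\<^sub>2 - l\<^sub>1) * (1 - y) - (1 - l\<^sub>1) * (1 - l\<^sub>2 * y) = (l\<^sub>2 - 1) * (1 - l\<^sub>1 * y)"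
        by (simp add: algebra_simps)
      finally have e: "1 - m * ((1 - l\<^sub>2 * y) / (1 - y))
          = (l\<^sub>2 - 1) * (1 - l\<^sub>1 * y) / ((l\<^sub>2 - l\<^sub>1) * (1 - y))" .
      have "A (l\<^sub>2 - 1) \<noteq> 0" "B (l\<^sub>2 - 1) \<noteq> 0" "B (l\<^sub>2 - l\<^sub>1) \<noteq> 0"
        "A (1 - y) \<noteq> 0" "B (1 - y) \<noteq> 0" "C (1 - y) \<noteq> 0"
        using nz ne y' by simp_all
      then show ?thesis
        unfolding k e one_minus[OF y] h_def c_def char_mult_def char_inv_def
          mult_char_mult[OF chars(1)] mult_char_mult[OF chars(2)]
          mult_char_divide[OF chars(1)] mult_char_divide[OF chars(2)] mult_char_divide[OF chars(3)]
        by (simp add: divide_simps)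
    qed
    then have "period_D2 A B (C \<cdot> char_inv B) C l\<^sub>1 l\<^sub>2 = c * ((\<Sum>z\<in>UNIV. k z) - k l\<^sub>2)"
      by (rule D)
    also have "(\<Sum>z\<in>UNIV. k z) = period_21 B (B \<cdot> char_inv C) (A \<cdot> B \<cdot> char_inv C) m"
      by (simp add: period_21_def k_def)
    also have "c * (\<dots> - k l\<^sub>2) = c * \<dots> - c * k l\<^sub>2"
      by (rule right_diff_distrib)
    \<comment> \<open>This is the value at \<open>y\<close> = infinity: the powers of
      \<open>l\<^sub>2 - 1\<close> and \<open>l\<^sub>2 - l\<^sub>1\<close> cancel against
      \<open>c\<close>.\<close>
    also have "c * k l\<^sub>2 = A (- 1) * (B \<cdot> char_inv C) l\<^sub>2 * char_inv B l\<^sub>1"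
    proof -
      have e: "1 - m * l\<^sub>2 = l\<^sub>1 * (l\<^sub>2 - 1) / (l\<^sub>2 - l\<^sub>1)"
        using ne by (simp add: m_def field_simps)
      show ?thesis
        unfolding k e using nz ne by (simp add: c_def A_swap char_mult_def char_inv_def divide_simps)
    qed
    finally show ?thesis
      using False by (simp add: c_def m_def delta_def)
  qed
qed

theorem proposition6p10:
  fixes A B B\<^sub>1 B\<^sub>2 C :: "'a::{field,finite} \<Rightarrow> complex"
    and l\<^sub>1 l\<^sub>2 :: 'a
    and p e :: nat
  assumes "prime p" and "odd p" and "card (UNIV :: 'a set) = p ^ e"
    and "A \<in> mult_chars" and "B \<in> mult_chars"
    and "B\<^sub>1 \<in> mult_chars" and "B\<^sub>2 \<in> mult_chars" and "C \<in> mult_chars"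
  shows
    "(l\<^sub>1 \<noteq> 0 \<longrightarrow>
        period_D2 A triv_char B\<^sub>2 C l\<^sub>1 l\<^sub>2 =
          period_21 B\<^sub>2 A C l\<^sub>2
          - (B\<^sub>2 \<cdot> char_inv C) l\<^sub>1 * (char_inv A \<cdot> C) (l\<^sub>1 - 1) * char_inv B\<^sub>2 (l\<^sub>1 - l\<^sub>2))
   \<and> (l\<^sub>1 \<noteq> 0 \<longrightarrow>
        period_D2 A B\<^sub>1 B\<^sub>2 A l\<^sub>1 l\<^sub>2 =
          char_inv A l\<^sub>1 * period_21 B\<^sub>2 A (A \<cdot> char_inv B\<^sub>1) (l\<^sub>2 / l\<^sub>1)
          - char_inv B\<^sub>1 (1 - l\<^sub>1) * char_inv B\<^sub>2 (1 - l\<^sub>2))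
   \<and> (l\<^sub>2 \<noteq> 1 \<longrightarrow>
        period_D2 A B (C \<cdot> char_inv B) C l\<^sub>1 l\<^sub>2 =
          (B \<cdot> char_inv A) (l\<^sub>2 - 1) * char_inv B (l\<^sub>2 - l\<^sub>1)
            * period_21 B (B \<cdot> char_inv C) (A \<cdot> B \<cdot> char_inv C) ((1 - l\<^sub>1) / (l\<^sub>2 - l\<^sub>1))
          - A (- 1) * (B \<cdot> char_inv C) l\<^sub>2 * char_inv B l\<^sub>1
          + delta (l\<^sub>2 - l\<^sub>1) * char_inv A (l\<^sub>1 - 1) * jacobi_sum A (char_inv C))
   \<and> (l\<^sub>1 \<noteq> 0 \<and> l\<^sub>1 \<noteq> 1 \<and> l\<^sub>2 \<noteq> 1 \<longrightarrow>
        period_D2 triv_char B\<^sub>1 B\<^sub>2 C l\<^sub>1 l\<^sub>2 =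
          (C \<cdot> char_inv B\<^sub>1) (1 - l\<^sub>1) * char_inv C (- l\<^sub>1) * char_inv B\<^sub>2 (1 - l\<^sub>2)
            * period_21 B\<^sub>2 C (C \<cdot> char_inv B\<^sub>1)
                ((l\<^sub>2 * (1 - l\<^sub>1)) / (l\<^sub>1 * (1 - l\<^sub>2)))
          - 1)"
  using assms(4-8)
  by (intro conjI impI period_D2_triv_char period_D2_lower_eq_upper period_D2_balanced
      period_D2_upper_eq_triv_char) auto

end
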